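(* Let $\mathfrak A$ be an algebra of subsets of a non-empty set $X$ and let $\alpha,\beta:\mathfrak A\to\mathbb R_+$ be nonnegative (finitely) additive set functions. There exist two nonnegative additive set functions $\beta_a,\beta_s$ on $\mathfrak A$ such that $\beta=\beta_a+\beta_s$, where $\beta_a$ is $\alpha$-absolutely continuous and $\beta_s$ is $\alpha$-singular.
   Context: For nonnegative finitely additive set functions $\alpha,\beta$ on $\mathfrak A$: $\beta$ is $\alpha$-absolutely continuous if for each $\varepsilon>0$ there is $\delta>0$ such that $R\in\mathfrak A$ and $\alpha(R)<\delta$ imply $\beta(R)<\varepsilon$. $\alpha$ and $\beta$ are mutually singular ($\beta$ is $\alpha$-singular) if $\gamma=0$ is the only nonnegative additive set function on $\mathfrak A$ such that $\gamma\le\alpha$ and $\gamma\le\beta$ (setwise). *)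

theory Defs
  imports "HOL-Analysis.Analysis"
begin

text \<open>
  A set function on an algebra \<open>M\<close> is a total function of type \<^typ>\<open>'a set \<Rightarrow> real\<close>; its values
  outside \<open>M\<close> are irrelevant, so all (in)equalities between set functions are relativised to \<open>M\<close>.
\<close>

definition nonneg_additive :: "'a set set \<Rightarrow> ('a set \<Rightarrow> real) \<Rightarrow> bool" where
  "nonneg_additive M \<mu> \<longleftrightarrow> (\<forall>R\<in>M. 0 \<le> \<mu> R) \<and> additive M \<mu>"

definition abs_continuous_charge ::
  "'a set set \<Rightarrow> ('a set \<Rightarrow> real) \<Rightarrow> ('a set \<Rightarrow> real) \<Rightarrow> bool" where
  "abs_continuous_charge M \<alpha> \<beta> \<longleftrightarrow>
     (\<forall>\<epsilon>>0. \<exists>\<delta>>0. \<forall>R\<in>M. \<alpha> R < \<delta> \<longrightarrow> \<beta> R < \<epsilon>)"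

definition mutually_singular_charge ::
  "'a set set \<Rightarrow> ('a set \<Rightarrow> real) \<Rightarrow> ('a set \<Rightarrow> real) \<Rightarrow> bool" where
  "mutually_singular_charge M \<alpha> \<beta> \<longleftrightarrow>
     (\<forall>\<gamma>. nonneg_additive M \<gamma> \<and> (\<forall>R\<in>M. \<gamma> R \<le> \<alpha> R) \<and> (\<forall>R\<in>M. \<gamma> R \<le> \<beta> R)
        \<longrightarrow> (\<forall>R\<in>M. \<gamma> R = 0))"

end

theory Submission
  imports Defs
begin

text \<open>
  The absolutely continuous part of \<open>\<beta>\<close> is the limit of the increasing sequence of lattice infima
  \<open>\<beta> \<and> n\<alpha>\<close>, where \<open>(\<alpha> \<and> \<beta>)(R)\<close> is the infimum of \<open>\<alpha>(S) + \<beta>(R - S)\<close> over \<open>S \<subseteq> R\<close>. The convergence is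
  uniform on the algebra, since the error is a nonnegative charge and hence bounded by its value
  at \<open>X\<close>; as \<open>\<beta> \<and> n\<alpha> \<le> n\<alpha>\<close>, the limit is absolutely continuous. If a charge \<open>\<gamma>\<close> lies below both \<open>\<alpha>\<close>
  and the remainder, then \<open>(\<beta> \<and> n\<alpha>) + \<gamma> \<le> \<beta> \<and> (n+1)\<alpha>\<close> for all \<open>n\<close>, which forces \<open>\<gamma> = 0\<close>.
\<close>

lemma nonneg_additiveI:
  assumes "\<And>R. R \<in> M \<Longrightarrow> 0 \<le> \<mu> R"
    and "\<And>R T. R \<in> M \<Longrightarrow> T \<in> M \<Longrightarrow> R \<inter> T = {} \<Longrightarrow> \<mu> (R \<union> T) = \<mu> R + \<mu> T"
  shows "nonneg_additive M \<mu>"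
  using assms by (simp add: nonneg_additive_def additive_def)

lemma nonneg_additive_nonneg: "nonneg_additive M \<mu> \<Longrightarrow> R \<in> M \<Longrightarrow> 0 \<le> \<mu> R"
  by (simp add: nonneg_additive_def)

lemma nonneg_additive_Un:
  "nonneg_additive M \<mu> \<Longrightarrow> R \<in> M \<Longrightarrow> T \<in> M \<Longrightarrow> R \<inter> T = {} \<Longrightarrow> \<mu> (R \<union> T) = \<mu> R + \<mu> T"
  by (simp add: nonneg_additive_def additive_def)

lemma nonneg_additive_scale:
  "nonneg_additive M \<mu> \<Longrightarrow> 0 \<le> c \<Longrightarrow> nonneg_additive M (\<lambda>R. c * \<mu> R)"
  by (simp add: nonneg_additive_def additive_def distrib_left)

lemma nonneg_additive_add:
  "nonneg_additive M \<mu> \<Longrightarrow> nonneg_additive M \<nu> \<Longrightarrow> nonneg_additive M (\<lambda>R. \<mu> R + \<nu> R)"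
  by (simp add: nonneg_additive_def additive_def)

lemma nonneg_additive_diff:
  assumes "nonneg_additive M \<mu>" "nonneg_additive M \<nu>" "\<And>R. R \<in> M \<Longrightarrow> \<nu> R \<le> \<mu> R"
  shows "nonneg_additive M (\<lambda>R. \<mu> R - \<nu> R)"
  using assms by (simp add: nonneg_additive_def additive_def)

lemma nonneg_additive_tendsto:
  assumes "\<And>n. nonneg_additive M (\<mu> n)" "\<And>R. R \<in> M \<Longrightarrow> (\<lambda>n. \<mu> n R) \<longlonglongrightarrow> \<nu> R"
    and "\<And>R T. R \<in> M \<Longrightarrow> T \<in> M \<Longrightarrow> R \<union> T \<in> M"
  shows "nonneg_additive M \<nu>"
proof (rule nonneg_additiveI)
  show "0 \<le> \<nu> R" if "R \<in> M" for R
    by (rule LIMSEQ_le_const[OF assms(2)[OF that]])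
      (simp add: nonneg_additive_nonneg[OF assms(1) that])
  fix R T assume RT: "R \<in> M" "T \<in> M" "R \<inter> T = {}"
  have "(\<lambda>n. \<mu> n R + \<mu> n T) \<longlonglongrightarrow> \<nu> (R \<union> T)"
    using assms(2)[OF assms(3)[OF RT(1,2)]] by (simp add: nonneg_additive_Un[OF assms(1) RT])
  moreover have "(\<lambda>n. \<mu> n R + \<mu> n T) \<longlonglongrightarrow> \<nu> R + \<nu> T"
    using assms(2) RT by (intro tendsto_add)
  ultimately show "\<nu> (R \<union> T) = \<nu> R + \<nu> T"
    by (rule LIMSEQ_unique)
qed

text \<open>An infimum of reals is meaningful only over a nonempty set that is bounded below. For
  \<open>R \<in> M\<close> the choice \<open>S = R\<close> is available, and nonnegativity of both
  charges gives the lower bound 0.\<close>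

definition charge_inf :: "'a set set \<Rightarrow> ('a set \<Rightarrow> real) \<Rightarrow> ('a set \<Rightarrow> real) \<Rightarrow> 'a set \<Rightarrow> real" where
  "charge_inf M \<alpha> \<beta> R = (INF S\<in>{S \<in> M. S \<subseteq> R}. \<alpha> S + \<beta> (R - S))"

context algebra
begin

lemma nonneg_additive_empty: "nonneg_additive M \<mu> \<Longrightarrow> \<mu> {} = 0"
  using nonneg_additive_Un[of M \<mu> "{}" "{}"] by simp

lemma nonneg_additive_split:
  assumes "nonneg_additive M \<mu>" "R \<in> M" "S \<in> M" "S \<subseteq> R"
  shows "\<mu> R = \<mu> S + \<mu> (R - S)"
  using nonneg_additive_Un[OF assms(1), of S "R - S"] assms by (simp add: Diff Un_absorb1)

lemma nonneg_additive_mono: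
  assumes "nonneg_additive M \<mu>" "R \<in> M" "S \<in> M" "S \<subseteq> R"
  shows "\<mu> S \<le> \<mu> R"
  using nonneg_additive_split[OF assms] nonneg_additive_nonneg[OF assms(1), of "R - S"] assms
  by (simp add: Diff)

lemma charge_inf_le:
  assumes "nonneg_additive M \<alpha>" "nonneg_additive M \<beta>" "R \<in> M" "S \<in> M" "S \<subseteq> R"
  shows "charge_inf M \<alpha> \<beta> R \<le> \<alpha> S + \<beta> (R - S)"
  unfolding charge_inf_def
proof (rule cINF_lower)
  show "bdd_below ((\<lambda>S. \<alpha> S + \<beta> (R - S)) ` {S \<in> M. S \<subseteq> R})"
    using assms by (intro bdd_belowI2[where m = 0]) (auto intro!: add_nonneg_nonneg nonneg_additive_nonneg[of M \<alpha>] nonneg_additive_nonneg[of M \<beta>])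
qed (use assms in simp)

lemma charge_inf_greatest:
  assumes "R \<in> M" "\<And>S. S \<in> M \<Longrightarrow> S \<subseteq> R \<Longrightarrow> c \<le> \<alpha> S + \<beta> (R - S)"
  shows "c \<le> charge_inf M \<alpha> \<beta> R"
  unfolding charge_inf_def using assms by (intro cINF_greatest) auto

lemma charge_inf_le1:
  assumes "nonneg_additive M \<alpha>" "nonneg_additive M \<beta>" "R \<in> M"
  shows "charge_inf M \<alpha> \<beta> R \<le> \<alpha> R"
  \<comment> \<open>The second use of \<open>assms(3)\<close> selects \<open>S = R\<close>, the
    trivial splitting, whose remaining term \<open>\<beta> {}\<close> vanishes.\<close>
  using charge_inf_le[OF assms assms(3)] by (simp add: nonneg_additive_empty[OF assms(2)])

lemma charge_inf_le2:
  assumes "nonneg_additive M \<alpha>" "nonneg_additive M \<beta>" "R \<in> M"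
  shows "charge_inf M \<alpha> \<beta> R \<le> \<beta> R"
  using charge_inf_le[OF assms, of "{}"] by (simp add: nonneg_additive_empty[OF assms(1)])

text \<open>Any \<open>S\<close> splits \<open>\<gamma> R\<close> into
  \<open>\<gamma> S + \<gamma> (R - S)\<close>; the first term is bounded through \<alpha>, the
  second through \<beta>.\<close>

lemma charge_inf_glb:
  assumes "nonneg_additive M \<gamma>" "\<And>R. R \<in> M \<Longrightarrow> \<gamma> R \<le> \<alpha> R" "\<And>R. R \<in> M \<Longrightarrow> \<gamma> R \<le> \<beta> R" "R \<in> M"
  shows "\<gamma> R \<le> charge_inf M \<alpha> \<beta> R"
proof (rule charge_inf_greatest[OF assms(4)])
  fix S assume S: "S \<in> M" "S \<subseteq> R"
  then show "\<gamma> R \<le> \<alpha> S + \<beta> (R - S)"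
    using nonneg_additive_split[OF assms(1,4) S] assms(2)[of S] assms(3)[of "R - S"] assms(4)
    by (simp add: Diff)
qed

text \<open>Splittings of two disjoint sets glue to a splitting of their union, which gives \<le>;
  conversely a splitting of the union restricts to each piece, which gives \<ge>. Additivity of
  \<alpha> and \<beta> makes the costs add up in both directions.\<close>

lemma nonneg_additive_charge_inf:
  assumes \<alpha>: "nonneg_additive M \<alpha>" and \<beta>: "nonneg_additive M \<beta>"
  shows "nonneg_additive M (charge_inf M \<alpha> \<beta>)"
proof (rule nonneg_additiveI)
  show "0 \<le> charge_inf M \<alpha> \<beta> R" if "R \<in> M" for R
    using that by (intro charge_inf_greatest add_nonneg_nonneg
        nonneg_additive_nonneg[OF \<alpha>] nonneg_additive_nonneg[OF \<beta>]) auto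
  fix R T assume RT: "R \<in> M" "T \<in> M" "R \<inter> T = {}"
  have sum_le: "charge_inf M \<alpha> \<beta> (R \<union> T) \<le> (\<alpha> S + \<beta> (R - S)) + (\<alpha> U + \<beta> (T - U))"
    if "S \<in> M" "S \<subseteq> R" "U \<in> M" "U \<subseteq> T" for S U
  proof -
    have "(R \<union> T) - (S \<union> U) = (R - S) \<union> (T - U)"
      using that RT by blast
    moreover have "\<alpha> (S \<union> U) = \<alpha> S + \<alpha> U"
      using that RT by (intro nonneg_additive_Un[OF \<alpha>]) auto
    moreover have "\<beta> ((R - S) \<union> (T - U)) = \<beta> (R - S) + \<beta> (T - U)"
      using that RT by (intro nonneg_additive_Un[OF \<beta>]) auto
    ultimately show ?thesis
      using charge_inf_le[OF \<alpha> \<beta>, of "R \<union> T" "S \<union> U"] that RT by (simp add: Un le_supI1 le_supI2 ac_simps)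
  qed
  \<comment> \<open>The two infima are taken one at a time: first over splittings of
    \<open>R\<close> with \<open>U\<close> fixed, then over \<open>U\<close>.\<close>
  have "charge_inf M \<alpha> \<beta> (R \<union> T) - (\<alpha> U + \<beta> (T - U)) \<le> charge_inf M \<alpha> \<beta> R"
    if "U \<in> M" "U \<subseteq> T" for U
    using sum_le that by (intro charge_inf_greatest[OF RT(1)]) (simp add: diff_le_eq)
  then have "charge_inf M \<alpha> \<beta> (R \<union> T) - charge_inf M \<alpha> \<beta> R \<le> charge_inf M \<alpha> \<beta> T"
    by (intro charge_inf_greatest[OF RT(2)]) (simp add: diff_le_eq add.commute)
  moreover have "charge_inf M \<alpha> \<beta> R + charge_inf M \<alpha> \<beta> T \<le> charge_inf M \<alpha> \<beta> (R \<union> T)"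
  proof (rule charge_inf_greatest)
    fix S assume S: "S \<in> M" "S \<subseteq> R \<union> T"
    have "\<alpha> S = \<alpha> (S \<inter> R) + \<alpha> (S \<inter> T)"
      using nonneg_additive_Un[OF \<alpha>, of "S \<inter> R" "S \<inter> T"] S RT
      by (simp add: Int Int_Un_distrib[symmetric] Int_absorb2 Int_assoc Int_left_commute)
    moreover have "\<beta> (R \<union> T - S) = \<beta> (R - S \<inter> R) + \<beta> (T - S \<inter> T)"
    proof -
      have "R \<union> T - S = (R - S \<inter> R) \<union> (T - S \<inter> T)" by blast
      then show ?thesis
        using nonneg_additive_Un[OF \<beta>, of "R - S \<inter> R" "T - S \<inter> T"] S RT by auto
    qed
    moreover have "charge_inf M \<alpha> \<beta> R \<le> \<alpha> (S \<inter> R) + \<beta> (R - S \<inter> R)"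
      "charge_inf M \<alpha> \<beta> T \<le> \<alpha> (S \<inter> T) + \<beta> (T - S \<inter> T)"
      using S RT by (auto intro!: charge_inf_le[OF \<alpha> \<beta>])
    ultimately show "charge_inf M \<alpha> \<beta> R + charge_inf M \<alpha> \<beta> T \<le> \<alpha> S + \<beta> (R \<union> T - S)"
      by simp
  qed (use RT in blast)
  ultimately show "charge_inf M \<alpha> \<beta> (R \<union> T) = charge_inf M \<alpha> \<beta> R + charge_inf M \<alpha> \<beta> T"
    by simp
qed

end

theorem theorem8p5:
  fixes X :: "'a set" and M :: "'a set set" and \<alpha> \<beta> :: "'a set \<Rightarrow> real"
  assumes "X \<noteq> {}" and "algebra X M"
    and "nonneg_additive M \<alpha>" and "nonneg_additive M \<beta>"
  shows "\<exists>\<beta>\<^sub>a \<beta>\<^sub>s. nonneg_additive M \<beta>\<^sub>a \<and> nonneg_additive M \<beta>\<^sub>s \<and>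
    (\<forall>R\<in>M. \<beta> R = \<beta>\<^sub>a R + \<beta>\<^sub>s R) \<and>
    abs_continuous_charge M \<alpha> \<beta>\<^sub>a \<and> mutually_singular_charge M \<alpha> \<beta>\<^sub>s"
proof -
  interpret algebra X M by fact
  note \<alpha> = assms(3) and \<beta> = assms(4)
  define \<mu> where "\<mu> n = charge_inf M (\<lambda>R. real n * \<alpha> R) \<beta>" for n
  have n\<alpha>: "nonneg_additive M (\<lambda>R. real n * \<alpha> R)" for n
    using \<alpha> by (rule nonneg_additive_scale) simp
  have \<mu>: "nonneg_additive M (\<mu> n)" for n
    unfolding \<mu>_def using n\<alpha> \<beta> by (rule nonneg_additive_charge_inf)
  have \<mu>_le: "\<mu> n R \<le> real n * \<alpha> R" "\<mu> n R \<le> \<beta> R" if "R \<in> M" for n R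
    unfolding \<mu>_def by (rule charge_inf_le1[OF n\<alpha> \<beta> that] charge_inf_le2[OF n\<alpha> \<beta> that])+
  \<comment> \<open>The charge \<open>\<mu> n + \<gamma>\<close> lies below both
    \<open>n\<alpha> + \<alpha> = (n+1)\<alpha>\<close> and \<beta>, hence below their lattice
    infimum. With \<open>\<gamma> = 0\<close> this yields monotonicity in \<open>n\<close>; with
    \<gamma> below the remainder it yields singularity.\<close>
  have step: "\<mu> n R + \<gamma> R \<le> \<mu> (Suc n) R"
    if "nonneg_additive M \<gamma>" "\<And>R. R \<in> M \<Longrightarrow> \<gamma> R \<le> \<alpha> R" "\<And>R. R \<in> M \<Longrightarrow> \<mu> n R + \<gamma> R \<le> \<beta> R" "R \<in> M"
    for n \<gamma> R
    unfolding \<mu>_def[of "Suc n"] using that \<mu>_le(1)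
    by (intro charge_inf_glb nonneg_additive_add \<mu>) (auto simp: distrib_right add.commute[of "\<alpha> _"] intro!: add_mono)
  have inc: "incseq (\<lambda>n. \<mu> n R)" if "R \<in> M" for R
    using step[of "\<lambda>_. 0", OF _ _ _ that] \<mu>_le(2) nonneg_additive_nonneg[OF \<alpha>]
    by (intro incseq_SucI) (simp add: nonneg_additiveI)
  \<comment> \<open>For \<open>R \<in> M\<close> the sequence is increasing and bounded by
    \<open>\<beta> R\<close>, so \<open>lim\<close> is a true limit there; its values outside
    \<open>M\<close> are irrelevant.\<close>
  define \<beta>a where "\<beta>a R = lim (\<lambda>n. \<mu> n R)" for R
  have lim: "(\<lambda>n. \<mu> n R) \<longlonglongrightarrow> \<beta>a R" if "R \<in> M" for R
    unfolding \<beta>a_def convergent_LIMSEQ_iff[symmetric]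
    using inc[OF that] \<mu>_le(2)[OF that] by (metis incseq_convergent convergent_def)
  have \<beta>a: "nonneg_additive M \<beta>a"
    by (rule nonneg_additive_tendsto[OF \<mu> lim]) auto
  have \<mu>_le_\<beta>a: "\<mu> n R \<le> \<beta>a R" if "R \<in> M" for n R
    using inc[OF that] lim[OF that] by (rule incseq_le)
  have \<beta>a_le: "\<beta>a R \<le> \<beta> R" if "R \<in> M" for R
    using LIMSEQ_le_const2[OF lim[OF that]] \<mu>_le(2)[OF that] by blast
  have "abs_continuous_charge M \<alpha> \<beta>a"
    unfolding abs_continuous_charge_def
  proof (intro allI impI)
    fix \<epsilon> :: real assume "0 < \<epsilon>"
    then have "\<forall>\<^sub>F n in sequentially. \<beta>a X - \<epsilon> / 2 < \<mu> n X"
      by (intro order_tendstoD(1)[OF lim]) auto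
    then obtain n where n: "\<beta>a X - \<epsilon> / 2 < \<mu> n X"
      using eventually_happens by force
    \<comment> \<open>Half of \<epsilon> pays for \<open>\<mu> n R \<le> n * \<alpha> R\<close>, the
      other half for the error \<open>\<beta>a - \<mu> n\<close>. Dividing by \<open>n + 1\<close>
      instead of \<open>n\<close> keeps the bound on \<open>\<alpha> R\<close> meaningful for
      \<open>n = 0\<close>.\<close>
    have "\<beta>a R < \<epsilon>" if "R \<in> M" "\<alpha> R < \<epsilon> / (2 * (real n + 1))" for R
    proof -
      have "real n * \<alpha> R \<le> (real n + 1) * \<alpha> R"
        using nonneg_additive_nonneg[OF \<alpha> that(1)] by (simp add: distrib_right)
      also have "\<dots> < \<epsilon> / 2"
        using that(2) by (simp add: field_simps)
      finally have "\<mu> n R < \<epsilon> / 2"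
        using \<mu>_le(1)[OF that(1), of n] by simp
      moreover have "\<beta>a R - \<mu> n R \<le> \<beta>a X - \<mu> n X"
        using nonneg_additive_mono[OF nonneg_additive_diff[OF \<beta>a \<mu> \<mu>_le_\<beta>a]] that sets_into_space
        by simp
      ultimately show ?thesis using n by simp
    qed
    then show "\<exists>\<delta>>0. \<forall>R\<in>M. \<alpha> R < \<delta> \<longrightarrow> \<beta>a R < \<epsilon>"
      using \<open>0 < \<epsilon>\<close> by (intro exI[of _ "\<epsilon> / (2 * (real n + 1))"]) auto
  qed
  moreover have "mutually_singular_charge M \<alpha> (\<lambda>R. \<beta> R - \<beta>a R)"
    unfolding mutually_singular_charge_def
  proof (intro allI impI ballI, elim conjE)
    fix \<gamma> R
    assume \<gamma>: "nonneg_additive M \<gamma>" "\<forall>R\<in>M. \<gamma> R \<le> \<alpha> R" "\<forall>R\<in>M. \<gamma> R \<le> \<beta> R - \<beta>a R" and R: "R \<in> M"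
    \<comment> \<open>Since \<open>\<mu> n \<le> \<beta>a\<close> and
      \<open>\<gamma> \<le> \<beta> - \<beta>a\<close>, the sum stays below \<beta> for every
      \<open>n\<close>, with the same \<gamma>.\<close>
    have "\<mu> n R + \<gamma> R \<le> \<mu> (Suc n) R" for n
    proof (rule step[OF \<gamma>(1) _ _ R])
      show "\<mu> n T + \<gamma> T \<le> \<beta> T" if "T \<in> M" for T
        using \<mu>_le_\<beta>a[OF that, of n] \<gamma>(3) that by force
    qed (use \<gamma>(2) in simp)
    moreover have "(\<lambda>n. \<mu> n R + \<gamma> R) \<longlonglongrightarrow> \<beta>a R + \<gamma> R"
      by (intro tendsto_intros lim R)
    \<comment> \<open>The shifted sequence has the same limit \<open>\<beta>a R\<close>, so the
      limit of the inequalities leaves no room for a positive \<open>\<gamma> R\<close>.\<close>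
    ultimately have "\<beta>a R + \<gamma> R \<le> \<beta>a R"
      using LIMSEQ_le[OF _ LIMSEQ_Suc[OF lim[OF R]]] by blast
    then show "\<gamma> R = 0"
      using nonneg_additive_nonneg[OF \<gamma>(1) R] by simp
  qed
  ultimately show ?thesis
    using \<beta>a nonneg_additive_diff[OF \<beta> \<beta>a \<beta>a_le]
    by (intro exI[of _ \<beta>a] exI[of _ "\<lambda>R. \<beta> R - \<beta>a R"]) simp
qed

end
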